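(* For every integer $k>1$, $$\varepsilon(2,k)=\frac{1}{\sqrt{(k-1)^2+k^2}}.$$
   Context: For positive integers $d$ and $k$, a lattice $(d,k)$-polytope is the convex hull of a (finite, nonempty) set of points of $\mathbb{R}^d$ whose coordinates are integers between $0$ and $k$, i.e. points of $\{0,1,\ldots,k\}^d$. The quantity $\varepsilon(d,k)$ denotes the smallest possible Euclidean distance $d(P,Q)=\min\{\|p-q\|: p\in P, q\in Q\}$ between two disjoint lattice $(d,k)$-polytopes $P$ and $Q$. *)

theory Defs
  imports "HOL-Analysis.Analysis"
begin

definition lattice_grid :: "nat \<Rightarrow> (real ^ 'n) set" where
  "lattice_grid k = {v. \<forall>i. v $ i \<in> \<int> \<and> 0 \<le> v $ i \<and> v $ i \<le> real k}"

definition lattice_polytope :: "nat \<Rightarrow> (real ^ 'n) set \<Rightarrow> bool" where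
  "lattice_polytope k P \<longleftrightarrow>
     (\<exists>V. finite V \<and> V \<noteq> {} \<and> V \<subseteq> lattice_grid k \<and> P = convex hull V)"

definition polytope_distances :: "'n::finite itself \<Rightarrow> nat \<Rightarrow> real set" where
  "polytope_distances _ k =
     {setdist P Q | P Q :: (real ^ 'n) set.
        lattice_polytope k P \<and> lattice_polytope k Q \<and> P \<inter> Q = {}}"

text \<open>
  The dimension \<open>d\<close> is the cardinality of the index type \<open>'n\<close>, so \<open>\<epsilon>(d, k)\<close> is
  \<open>lattice_eps TYPE('n) k\<close>. The lemmas below show that both minima are genuine: the infimum
  in \<^const>\<open>setdist\<close> is attained, and for \<open>k \<ge> 1\<close> the set under \<^const>\<open>Min\<close> is finite and
  nonempty.
\<close>

definition lattice_eps :: "'n::finite itself \<Rightarrow> nat \<Rightarrow> real" where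
  "lattice_eps d k = Min (polytope_distances d k)"

lemma finite_lattice_grid: "finite (lattice_grid k :: (real ^ 'n) set)"
proof -
  have "lattice_grid k \<subseteq> (\<lambda>f :: 'n \<Rightarrow> real. \<chi> i. f i) ` (UNIV \<rightarrow>\<^sub>E real ` {..k})"
  proof
    fix v :: "real ^ 'n"
    assume v: "v \<in> lattice_grid k"
    have "v $ i \<in> real ` {..k}" for i
    proof -
      from v obtain m where m: "v $ i = of_int m" "0 \<le> v $ i" "v $ i \<le> real k"
        unfolding lattice_grid_def mem_Collect_eq by (metis Ints_cases)
      then have "v $ i = real (nat m)" "nat m \<le> k" by auto
      then show ?thesis by auto
    qed
    then have "(\<lambda>i. v $ i) \<in> UNIV \<rightarrow>\<^sub>E real ` {..k}" by auto
    moreover have "v = (\<chi> i. v $ i)" by simp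
    ultimately show "v \<in> (\<lambda>f :: 'n \<Rightarrow> real. \<chi> i. f i) ` (UNIV \<rightarrow>\<^sub>E real ` {..k})" by blast
  qed
  then show ?thesis
    by (rule finite_subset) (intro finite_imageI finite_PiE; simp)
qed

lemma finite_polytope_distances: "finite (polytope_distances d k)"
proof -
  let ?S = "Pow (lattice_grid k :: (real ^ 'a) set)"
  have "polytope_distances d k \<subseteq> (\<lambda>(V, W). setdist (convex hull V) (convex hull W)) ` (?S \<times> ?S)"
    unfolding polytope_distances_def lattice_polytope_def by fastforce
  then show ?thesis
    by (rule finite_subset) (simp add: finite_lattice_grid)
qed

lemma polytope_distances_nonempty:
  assumes "k \<ge> 1"
  shows "polytope_distances (d :: 'n::finite itself) k \<noteq> {}"
proof -
  have "lattice_polytope k {0 :: real ^ 'n}"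
    unfolding lattice_polytope_def lattice_grid_def
    by (rule exI[of _ "{0}"]) auto
  moreover have "lattice_polytope k {1 :: real ^ 'n}"
    unfolding lattice_polytope_def lattice_grid_def
    using assms by (intro exI[of _ "{1}"]) auto
  moreover have "{0 :: real ^ 'n} \<inter> {1} = {}"
    by (auto simp: vec_eq_iff)
  ultimately show ?thesis
    unfolding polytope_distances_def by blast
qed

lemma setdist_lattice_polytopes_attained:
  assumes "lattice_polytope k P" "lattice_polytope k Q"
  shows "\<exists>p\<in>P. \<exists>q\<in>Q. setdist P Q = norm (p - q) \<and> (\<forall>x\<in>P. \<forall>y\<in>Q. norm (p - q) \<le> norm (x - y))"
proof -
  have "compact P" "compact Q" "P \<noteq> {}" "Q \<noteq> {}"
    using assms unfolding lattice_polytope_def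
    by (auto intro: finite_imp_compact_convex_hull)
  then obtain p q where "p \<in> P" "q \<in> Q" "dist p q = setdist P Q"
    using setdist_compact_closed[of P Q] compact_imp_closed by metis
  then show ?thesis
    using setdist_le_dist by (metis dist_norm)
qed

end

theory Submission
  imports Defs
begin

text \<open>
  Let \<open>p\<close>, \<open>q\<close> be closest points of the two polygons and \<open>z = p - q\<close>. The faces of the polygons
  in the directions of \<open>z\<close> that contain \<open>p\<close> and \<open>q\<close> are orthogonal to \<open>z\<close>. If both are single
  points, then \<open>z\<close> is a nonzero integer vector. Otherwise \<open>z\<close> is orthogonal to a nonzero difference
  \<open>e\<close> of two grid points, and \<open>norm z = \<bar>det (e, d)\<bar> / norm e\<close>, where \<open>d\<close> is a difference of
  vertices on the two faces. The determinant is a nonzero integer, and it is a multiple of \<open>k\<close> if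
  both entries of \<open>e\<close> are \<open>\<plusminus>k\<close>; in all other cases \<open>norm e\<close> is at most the norm of \<open>(k, k - 1)\<close>.
  Equality holds for the segment from \<open>(0, 0)\<close> to \<open>(k, k - 1)\<close> and the point \<open>(1, 1)\<close>.
\<close>

lemma norm_vec_2_squared: "(norm (x :: real ^ 2))\<^sup>2 = (x $ 1)\<^sup>2 + (x $ 2)\<^sup>2"
  unfolding power2_norm_eq_inner by (simp add: inner_vec_def sum_2 power2_eq_square)

lemma inner_vec_2: "(x :: real ^ 2) \<bullet> y = x $ 1 * y $ 1 + x $ 2 * y $ 2"
  by (simp add: inner_vec_def sum_2)

lemma Ints_nonzero_square_ge_1:
  fixes x :: real
  assumes "x \<in> \<int>" "x \<noteq> 0"
  shows "1 \<le> x\<^sup>2"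
  using Ints_nonzero_abs_ge1[OF assms] by (metis one_le_power power2_abs)

text \<open>Only \<open>e\<close> with both entries of absolute value \<open>k\<close> can be longer
  than \<open>(k, k - 1)\<close>, and there the divisibility of the determinant by \<open>k\<close>
  makes up for it. For any other \<open>e\<close>, integrality pushes one entry down to at most
  \<open>k - 1\<close>, and a nonzero integer determinant suffices.\<close>

lemma det_square_lower_bound:
  fixes e1 e2 d1 d2 :: real and k :: nat
  assumes int: "e1 \<in> \<int>" "e2 \<in> \<int>" "d1 \<in> \<int>" "d2 \<in> \<int>"
    and le: "\<bar>e1\<bar> \<le> k" "\<bar>e2\<bar> \<le> k" and k: "k > 1"
    and nz: "e1 * d2 - e2 * d1 \<noteq> 0"
  shows "e1\<^sup>2 + e2\<^sup>2 \<le> (e1 * d2 - e2 * d1)\<^sup>2 * ((real k - 1)\<^sup>2 + (real k)\<^sup>2)"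
proof (cases "\<bar>e1\<bar> = k \<and> \<bar>e2\<bar> = k")
  case True
  \<comment> \<open>As both entries have absolute value \<open>k\<close>, \<open>c\<close> is the
    determinant divided by \<open>k\<close>.\<close>
  define c where "c = sgn e1 * d2 - sgn e2 * d1"
  have D: "e1 * d2 - e2 * d1 = k * c"
    using True by (metis c_def mult.assoc mult.commute right_diff_distrib mult_sgn_abs)
  have "c \<in> \<int>"
    unfolding c_def using int by (auto simp: sgn_if)
  moreover have "c \<noteq> 0"
    using nz D by auto
  ultimately have c: "1 \<le> c\<^sup>2"
    by (rule Ints_nonzero_square_ge_1)
  have sq: "e1\<^sup>2 = (real k)\<^sup>2" "e2\<^sup>2 = (real k)\<^sup>2"
    using True by (metis power2_abs)+
  have "2\<^sup>2 \<le> (real k)\<^sup>2"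
    using k by (intro power_mono) auto
  then have M: "2 \<le> (real k - 1)\<^sup>2 + (real k)\<^sup>2"
    by (intro add_increasing) auto
  have "e1\<^sup>2 + e2\<^sup>2 = (real k)\<^sup>2 * (1 * 2)"
    by (simp add: sq)
  also have "\<dots> \<le> (real k)\<^sup>2 * (c\<^sup>2 * ((real k - 1)\<^sup>2 + (real k)\<^sup>2))"
    using c M by (intro mult_left_mono mult_mono) auto
  finally show ?thesis
    by (simp add: D power_mult_distrib mult.assoc)
next
  case False
  have ei: "\<bar>e1\<bar> \<le> real k - 1 \<or> \<bar>e2\<bar> \<le> real k - 1"
  proof -
    obtain a b :: int where ab: "e1 = a" "e2 = b"
      using int by (auto elim!: Ints_cases)
    then have "\<bar>a\<bar> \<le> int k" "\<bar>b\<bar> \<le> int k" "\<not> (\<bar>a\<bar> = int k \<and> \<bar>b\<bar> = int k)"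
      using le False by linarith+
    then have "\<bar>a\<bar> \<le> int k - 1 \<or> \<bar>b\<bar> \<le> int k - 1"
      by linarith
    then show ?thesis
      using ab by linarith
  qed
  have "e1\<^sup>2 \<le> (real k)\<^sup>2" "e2\<^sup>2 \<le> (real k)\<^sup>2"
    using le by (simp_all add: abs_le_square_iff[symmetric])
  moreover have "e1\<^sup>2 \<le> (real k - 1)\<^sup>2 \<or> e2\<^sup>2 \<le> (real k - 1)\<^sup>2"
    using ei k by (auto simp: abs_le_square_iff[symmetric])
  ultimately have "e1\<^sup>2 + e2\<^sup>2 \<le> 1 * ((real k - 1)\<^sup>2 + (real k)\<^sup>2)"
    by (metis add_mono add.commute mult_1)
  also have "\<dots> \<le> (e1 * d2 - e2 * d1)\<^sup>2 * ((real k - 1)\<^sup>2 + (real k)\<^sup>2)"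
    using int nz by (intro mult_right_mono Ints_nonzero_square_ge_1) auto
  finally show ?thesis .
qed

text \<open>The identity \<open>det(e, d) z = \<parallel>z\<parallel>\<^sup>2 (-e\<^sub>2, e\<^sub>1)\<close> gives \<open>det(e, d)\<^sup>2 = \<parallel>e\<parallel>\<^sup>2 \<parallel>z\<parallel>\<^sup>2\<close>.\<close>

lemma norm_lower_bound_if_orthogonal:
  fixes z d v v' :: "real ^ 2"
  assumes k: "k > 1"
    and v: "v \<in> lattice_grid k" "v' \<in> lattice_grid k" "v \<noteq> v'"
    and d: "d $ 1 \<in> \<int>" "d $ 2 \<in> \<int>"
    and z: "z \<noteq> 0" "z \<bullet> d = z \<bullet> z" "z \<bullet> v = z \<bullet> v'"
  shows "1 \<le> (norm z)\<^sup>2 * ((real k - 1)\<^sup>2 + (real k)\<^sup>2)"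
proof -
  define e where "e = v - v'"
  define N where "N = (norm z)\<^sup>2"
  define D where "D = e $ 1 * d $ 2 - e $ 2 * d $ 1"
  define E where "E = (e $ 1)\<^sup>2 + (e $ 2)\<^sup>2"
  have N: "N > 0" "N = (z $ 1)\<^sup>2 + (z $ 2)\<^sup>2"
    using z(1) by (auto simp: N_def norm_vec_2_squared[symmetric])
  have E: "E > 0"
    using v(3) unfolding E_def norm_vec_2_squared[symmetric] by (simp add: e_def)
  have zd: "z $ 1 * d $ 1 + z $ 2 * d $ 2 = N"
    using z(2) by (simp add: N inner_vec_2 power2_eq_square)
  have ze: "z $ 1 * e $ 1 + z $ 2 * e $ 2 = 0"
    using z(3) by (simp add: e_def inner_vec_2 algebra_simps)
  have "D * z $ 1 = - e $ 2 * N" "D * z $ 2 = e $ 1 * N"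
    unfolding D_def zd[symmetric] using ze by algebra+
  then have "D\<^sup>2 * N = E * N * N"
    unfolding N(2) E_def by algebra
  then have D: "D\<^sup>2 = E * N"
    using N(1) by simp
  have "D \<noteq> 0"
    using D E N(1) by auto
  moreover have "e $ i \<in> \<int>" "\<bar>e $ i\<bar> \<le> k" for i
  proof -
    have "v $ i \<in> \<int>" "v' $ i \<in> \<int>" "0 \<le> v $ i" "v $ i \<le> k" "0 \<le> v' $ i" "v' $ i \<le> k"
      using v(1,2) by (auto simp: lattice_grid_def)
    then show "e $ i \<in> \<int>" "\<bar>e $ i\<bar> \<le> k"
      by (auto simp: e_def)
  qed
  ultimately have "E \<le> D\<^sup>2 * ((real k - 1)\<^sup>2 + (real k)\<^sup>2)"
    unfolding E_def D_def using d k by (intro det_square_lower_bound) auto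
  \<comment> \<open>After substituting \<open>D\<^sup>2 = E * N\<close>, the length of
    \<open>e\<close> cancels.\<close>
  then have "E * 1 \<le> E * (N * ((real k - 1)\<^sup>2 + (real k)\<^sup>2))"
    by (simp add: D mult.assoc)
  then show ?thesis
    using E by (simp add: N_def)
qed

text \<open>The minimizers of the functional form a face, which is the hull of some \<open>S\<close>
  contained in \<open>V\<close>. Either \<open>S\<close> is a single point, necessarily
  \<open>p\<close>, or two of its points differ by a nonzero vector orthogonal to
  \<open>z\<close>.\<close>

lemma convex_hull_supporting_face:
  fixes V :: "'a :: euclidean_space set"
  assumes "finite V" "p \<in> convex hull V" "\<And>x. x \<in> convex hull V \<Longrightarrow> z \<bullet> p \<le> z \<bullet> x"
  obtains v where "v \<in> V" "z \<bullet> v = z \<bullet> p" "v = p \<or> (\<exists>v'\<in>V. v' \<noteq> v \<and> z \<bullet> v' = z \<bullet> p)"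
proof -
  have "(convex hull V \<inter> {x. z \<bullet> x = z \<bullet> p}) face_of (convex hull V)"
    using assms(3) by (intro face_of_Int_supporting_hyperplane_ge) auto
  then obtain S where S: "S \<subseteq> V" "convex hull V \<inter> {x. z \<bullet> x = z \<bullet> p} = convex hull S"
    using face_of_convex_hull_subset[OF finite_imp_compact[OF assms(1)]] by metis
  have p: "p \<in> convex hull S"
    using assms(2) by (simp flip: S(2))
  then obtain v where v: "v \<in> S"
    by fastforce
  have S': "z \<bullet> x = z \<bullet> p" if "x \<in> S" for x
    using hull_inc[OF that, of convex] by (simp flip: S(2))
  have "v = p \<or> (\<exists>v'\<in>V. v' \<noteq> v \<and> z \<bullet> v' = z \<bullet> p)"
  proof (cases "S = {v}")
    case True
    then show ?thesis
      using p by simp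
  next
    case False
    then obtain v' where "v' \<in> S" "v' \<noteq> v"
      using v by auto
    then show ?thesis
      using S(1) S' by auto
  qed
  then show thesis
    using v S(1) S' by (intro that[of v]) auto
qed

lemma setdist_lattice_polytopes_lower_bound:
  fixes P Q :: "(real ^ 2) set"
  assumes k: "k > 1" and P: "lattice_polytope k P" and Q: "lattice_polytope k Q" and "P \<inter> Q = {}"
  shows "1 / sqrt ((real k - 1)\<^sup>2 + (real k)\<^sup>2) \<le> setdist P Q"
proof -
  obtain V W where V: "finite V" "V \<subseteq> lattice_grid k" "P = convex hull V"
    and W: "finite W" "W \<subseteq> lattice_grid k" "Q = convex hull W"
    using P Q unfolding lattice_polytope_def by metis
  obtain p q where pq: "p \<in> P" "q \<in> Q" "setdist P Q = norm (p - q)"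
    "\<And>x y. x \<in> P \<Longrightarrow> y \<in> Q \<Longrightarrow> norm (p - q) \<le> norm (x - y)"
    using setdist_lattice_polytopes_attained[OF P Q] by metis
  define z where "z = p - q"
  define M where "M = (real k - 1)\<^sup>2 + (real k)\<^sup>2"
  have cl: "closed P" "convex P" "closed Q" "convex Q"
    using V W by (auto intro!: compact_imp_closed finite_imp_compact_convex_hull)
  \<comment> \<open>Since \<open>p\<close> is the point of the convex set \<open>P\<close> closest
    to \<open>q\<close>, the line through \<open>p\<close> orthogonal to \<open>z\<close> supports
    \<open>P\<close>; likewise for \<open>Q\<close> at \<open>q\<close>, with the opposite
    sign.\<close>
  have zP: "z \<bullet> p \<le> z \<bullet> x" if "x \<in> P" for x
  proof -
    have "\<forall>y\<in>P. dist q p \<le> dist q y"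
      using pq(2,4) by (simp add: dist_norm norm_minus_commute)
    then show ?thesis
      using any_closest_point_dot[OF cl(2,1) pq(1) that, of q]
      by (simp add: z_def inner_diff algebra_simps)
  qed
  have zQ: "(- z) \<bullet> q \<le> (- z) \<bullet> x" if "x \<in> Q" for x
  proof -
    have "\<forall>y\<in>Q. dist p q \<le> dist p y"
      using pq(1,4) by (simp add: dist_norm)
    then show ?thesis
      using any_closest_point_dot[OF cl(4,3) pq(2) that, of p]
      by (simp add: z_def inner_diff algebra_simps)
  qed
  have z0: "z \<noteq> 0"
    using pq(1,2) assms(4) by (auto simp: z_def)
  obtain v where v: "v \<in> V" "z \<bullet> v = z \<bullet> p" "v = p \<or> (\<exists>v'\<in>V. v' \<noteq> v \<and> z \<bullet> v' = z \<bullet> p)"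
    by (rule convex_hull_supporting_face[of V p z]) (use V(1,3) pq(1) zP in auto)
  obtain w where w: "w \<in> W" "z \<bullet> w = z \<bullet> q" "w = q \<or> (\<exists>w'\<in>W. w' \<noteq> w \<and> z \<bullet> w' = z \<bullet> q)"
    by (rule convex_hull_supporting_face[of W q "- z"]) (use W(1,3) pq(2) zQ in auto)
  have d: "(v - w) $ i \<in> \<int>" for i
    using v(1) w(1) V(2) W(2) by (auto simp: lattice_grid_def intro!: Ints_diff)
  have zd: "z \<bullet> (v - w) = z \<bullet> z"
    using v(2) w(2) by (simp add: z_def inner_diff_right)
  have M1: "1 \<le> M"
    using k unfolding M_def by (intro add_increasing) (auto simp: one_le_power)
  have "1 \<le> (norm z)\<^sup>2 * M"
  proof (cases "v = p \<and> w = q")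
    \<comment> \<open>Here \<open>z = v - w\<close> is itself a nonzero integer vector, so its norm
      is at least 1.\<close>
    case True
    then have i: "z $ 1 \<in> \<int>" "z $ 2 \<in> \<int>"
      using d by (auto simp: z_def)
    obtain j where "z $ j \<noteq> 0" "j = 1 \<or> j = 2"
      using z0 by (metis exhaust_2 vec_eq_iff zero_index)
    then have "1 \<le> (norm z)\<^sup>2"
      unfolding norm_vec_2_squared using i Ints_nonzero_square_ge_1[of "z $ j"]
      by (auto intro: add_increasing add_increasing2)
    then show ?thesis
      using M1 mult_mono[of 1 "(norm z)\<^sup>2" 1 M] by simp
  next
    case False
    then obtain x y where "x \<in> lattice_grid k" "y \<in> lattice_grid k" "x \<noteq> y" "z \<bullet> x = z \<bullet> y"
      using v w V(2) W(2) by (metis subsetD)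
    then show ?thesis
      unfolding M_def using norm_lower_bound_if_orthogonal[OF k _ _ _ d d z0 zd] by blast
  qed
  then have "1 \<le> sqrt ((norm z)\<^sup>2 * M)"
    by simp
  then have "1 \<le> norm z * sqrt M"
    by (simp add: real_sqrt_mult)
  then have "1 / sqrt M \<le> norm z"
    using M1 by (simp add: divide_le_eq)
  then show ?thesis
    by (simp add: pq(3) z_def M_def)
qed

lemma lattice_eps_witness:
  fixes k :: nat
  assumes "k > 1"
  obtains P Q :: "(real ^ 2) set" where "lattice_polytope k P" "lattice_polytope k Q" "P \<inter> Q = {}"
    "setdist P Q \<le> 1 / sqrt ((real k - 1)\<^sup>2 + (real k)\<^sup>2)"
proof -
  define M where "M = (real k - 1)\<^sup>2 + (real k)\<^sup>2"
  define a where "a = (vector [real k, real k - 1] :: real ^ 2)"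
  define b where "b = (vector [1, 1] :: real ^ 2)"
  define P where "P = convex hull {0, a}"
  \<comment> \<open>\<open>t *\<^sub>R a\<close> is the foot of the perpendicular from \<open>b\<close>\<close>
  define t where "t = (2 * real k - 1) / M"
  have ab: "a $ 1 = real k" "a $ 2 = real k - 1" "b $ 1 = 1" "b $ 2 = 1"
    by (simp_all add: a_def b_def)
  have M: "M > 0"
    using assms unfolding M_def by (intro add_nonneg_pos) auto
  have "real k - 1 \<in> \<int>"
    by (intro Ints_diff) auto
  then have grid: "0 \<in> lattice_grid k" "a \<in> lattice_grid k" "b \<in> lattice_grid k"
    using assms by (auto simp: lattice_grid_def forall_2 ab)
  have lp: "lattice_polytope k P"
    unfolding lattice_polytope_def P_def using grid by (intro exI[of _ "{0, a}"]) auto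
  have lq: "lattice_polytope k {b}"
    unfolding lattice_polytope_def using grid by (intro exI[of _ "{b}"]) auto
  have P: "P = {s *\<^sub>R a | s. 0 \<le> s \<and> s \<le> 1}"
    unfolding P_def segment_convex_hull[symmetric] closed_segment_def by simp
  have "s *\<^sub>R a \<noteq> b" for s
  proof
    assume "s *\<^sub>R a = b"
    then have "s * real k = 1" "s * (real k - 1) = 1"
      using ab by (metis vector_scaleR_component real_scaleR_def)+
    then show False
      by (simp add: algebra_simps)
  qed
  then have disj: "P \<inter> {b} = {}"
    unfolding P by auto
  \<comment> \<open>The difference of the two sides is 2(k - 1)^2. This places the foot of the
    perpendicular on the segment.\<close>
  have "2 * real k - 1 \<le> M"
    unfolding M_def using zero_le_power2[of "real k - 1"] zero_le_power2[of "real k - 2"]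
    by (simp add: power2_eq_square algebra_simps)
  then have "0 \<le> t" "t \<le> 1"
    unfolding t_def using M assms by auto
  then have "t *\<^sub>R a \<in> P"
    unfolding P by blast
  then have "setdist P {b} \<le> norm (t *\<^sub>R a - b)"
    by (metis setdist_le_dist singletonI dist_norm)
  also have "(norm (t *\<^sub>R a - b))\<^sup>2 = 1 / M"
  proof -
    have tM: "t * M = 2 * real k - 1"
      using M by (simp add: t_def)
    \<comment> \<open>Expansion of the square, with \<open>M\<close> the squared norm of
      \<open>a\<close>, 2k - 1 the inner product of \<open>a\<close> and \<open>b\<close>, and 2 the
      squared norm of \<open>b\<close>.\<close>
    have "(norm (t *\<^sub>R a - b))\<^sup>2 = t * (t * M) - 2 * t * (2 * real k - 1) + 2"
      unfolding norm_vec_2_squared M_def by (simp add: ab power2_eq_square algebra_simps)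
    also have "\<dots> = 2 - t * (2 * real k - 1)"
      unfolding tM by (simp add: algebra_simps)
    finally have "(norm (t *\<^sub>R a - b))\<^sup>2 * M = 2 * M - (t * M) * (2 * real k - 1)"
      by algebra
    \<comment> \<open>By Lagrange's identity, 2M - (2k - 1)^2 is the squared determinant of
      \<open>a\<close> and \<open>b\<close>, which is (k - (k - 1))^2.\<close>
    also have "\<dots> = 1"
      unfolding tM unfolding M_def by (simp add: power2_eq_square algebra_simps)
    finally show ?thesis
      using M by (simp add: field_simps)
  qed
  then have "norm (t *\<^sub>R a - b) = 1 / sqrt M"
    by (metis norm_ge_zero real_sqrt_divide real_sqrt_one real_sqrt_unique)
  finally show thesis
    using that lp lq disj unfolding M_def by blast
qed

theorem theorem1p1:
  fixes k :: nat
  assumes "k > 1"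
  shows "lattice_eps TYPE(2) k = 1 / sqrt ((real k - 1)\<^sup>2 + (real k)\<^sup>2)"
proof -
  let ?m = "1 / sqrt ((real k - 1)\<^sup>2 + (real k)\<^sup>2)"
  have lower: "?m \<le> r" if "r \<in> polytope_distances TYPE(2) k" for r
    using that assms setdist_lattice_polytopes_lower_bound unfolding polytope_distances_def by auto
  obtain P Q :: "(real ^ 2) set" where PQ: "lattice_polytope k P" "lattice_polytope k Q" "P \<inter> Q = {}"
    "setdist P Q \<le> ?m"
    using lattice_eps_witness[OF assms] .
  then have mem: "setdist P Q \<in> polytope_distances TYPE(2) k"
    unfolding polytope_distances_def by blast
  then have "setdist P Q = ?m"
    using lower PQ(4) by force
  then show ?thesis
    unfolding lattice_eps_def using mem lower by (intro Min_eqI finite_polytope_distances) auto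
qed

end
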